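(* Let $T$ be a $\{1,3\}$-tree and let $w,w'$ be two distinct vertices of $\mathcal{P}_T$, written $w=\frac12\mathbbm{1}_{H_w}$ and $w'=\frac12\mathbbm{1}_{H_{w'}}$ where $H_w,H_{w'}$ are collections of pairwise vertex-disjoint leaf-paths. Then $w$ and $w'$ are adjacent in the $1$-skeleton of $\mathcal{P}_T$ if and only if the symmetric difference of the edge sets of $H_w$ and $H_{w'}$ is the edge set of a single leaf-path.
   Context: A $\{1,3\}$-tree is a finite tree all of whose nodes have degree $1$ (leaves) or $3$ (internal nodes). A leaf-edge is an edge incident with a leaf; a leaf-path is a path in $T$ whose two extreme edges are leaf-edges (a single edge joining two leaves is a leaf-path). $\mathbbm{1}_H$ is the characteristic vector of the edge set of $H$. With $E$ the edge set, $\mathcal{P}_T\subset\mathbb{R}^E$ is the set of $w$ such that for every internal node $v$ with incident edges $a,b,c$: $w_a\le w_b+w_c$, $w_b\le w_a+w_c$, $w_c\le w_a+w_b$, $w_a+w_b+w_c\le1$; and if $T$ is a single edge $e$, $\mathcal{P}_T=\{w:0\le w_e\le\frac12\}$. Every vertex of $\mathcal{P}_T$ is of the form $\frac12\mathbbm{1}_H$ for a unique such collection $H$. *)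

theory Defs
  imports "HOL-Analysis.Analysis"
begin

text \<open>
  A finite graph is given by its node set \<open>V\<close> and the map \<open>ends\<close> sending each edge to its set of
  two end nodes. The edge set \<open>E\<close> is the whole finite type \<open>'e\<close>, so that the space of real vectors
  indexed by \<open>E\<close> is the Euclidean space \<open>real ^ 'e\<close>, where the library's faces, extreme points and
  polytope edges are available. A tree with nodes of degree 1 or 3 has at least one edge, so
  nonemptiness of \<open>'e\<close> excludes nothing.
\<close>

definition simple_graph :: "'v set \<Rightarrow> ('e::finite \<Rightarrow> 'v set) \<Rightarrow> bool" where
  "simple_graph V ends \<longleftrightarrow> finite V \<and> inj ends \<and> (\<forall>e. ends e \<subseteq> V \<and> card (ends e) = 2)"

definition incident :: "('e::finite \<Rightarrow> 'v set) \<Rightarrow> 'v \<Rightarrow> 'e set" where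
  "incident ends v = {e. v \<in> ends e}"

definition degree :: "('e::finite \<Rightarrow> 'v set) \<Rightarrow> 'v \<Rightarrow> nat" where
  "degree ends v = card (incident ends v)"

definition graph_path :: "'v set \<Rightarrow> ('e::finite \<Rightarrow> 'v set) \<Rightarrow> 'v list \<Rightarrow> 'e list \<Rightarrow> bool" where
  "graph_path V ends vs es \<longleftrightarrow>
     length vs = Suc (length es) \<and> set vs \<subseteq> V \<and> distinct vs \<and>
     (\<forall>i<length es. ends (es ! i) = {vs ! i, vs ! Suc i})"

definition connected_graph :: "'v set \<Rightarrow> ('e::finite \<Rightarrow> 'v set) \<Rightarrow> bool" where
  "connected_graph V ends \<longleftrightarrow> V \<noteq> {} \<and>
     (\<forall>u\<in>V. \<forall>v\<in>V. \<exists>vs es. graph_path V ends vs es \<and> hd vs = u \<and> last vs = v)"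

text \<open>A cycle is a path on at least three nodes together with an edge joining its two end nodes.\<close>

definition acyclic_graph :: "'v set \<Rightarrow> ('e::finite \<Rightarrow> 'v set) \<Rightarrow> bool" where
  "acyclic_graph V ends \<longleftrightarrow>
     \<not> (\<exists>vs es e. graph_path V ends vs es \<and> length vs \<ge> 3 \<and> ends e = {last vs, hd vs})"

definition one_three_tree :: "'v set \<Rightarrow> ('e::finite \<Rightarrow> 'v set) \<Rightarrow> bool" where
  "one_three_tree V ends \<longleftrightarrow>
     simple_graph V ends \<and> connected_graph V ends \<and> acyclic_graph V ends \<and>
     (\<forall>v\<in>V. degree ends v = 1 \<or> degree ends v = 3)"

definition leaf :: "'v set \<Rightarrow> ('e::finite \<Rightarrow> 'v set) \<Rightarrow> 'v \<Rightarrow> bool" where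
  "leaf V ends v \<longleftrightarrow> v \<in> V \<and> degree ends v = 1"

definition internal_node :: "'v set \<Rightarrow> ('e::finite \<Rightarrow> 'v set) \<Rightarrow> 'v \<Rightarrow> bool" where
  "internal_node V ends v \<longleftrightarrow> v \<in> V \<and> degree ends v = 3"

definition leaf_edge :: "'v set \<Rightarrow> ('e::finite \<Rightarrow> 'v set) \<Rightarrow> 'e \<Rightarrow> bool" where
  "leaf_edge V ends e \<longleftrightarrow> (\<exists>v\<in>ends e. leaf V ends v)"

text \<open>
  \<open>leaf_path V ends p\<close>: \<open>p\<close> is the edge set of a leaf-path. A path with at least one edge is
  determined by its edge set. A one-edge path is a leaf-path only if its edge joins two leaves;
  a single edge from a leaf to an internal node is not one.
\<close>

definition leaf_path :: "'v set \<Rightarrow> ('e::finite \<Rightarrow> 'v set) \<Rightarrow> 'e set \<Rightarrow> bool" where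
  "leaf_path V ends p \<longleftrightarrow>
     (\<exists>vs es. graph_path V ends vs es \<and> es \<noteq> [] \<and> set es = p \<and>
        leaf_edge V ends (hd es) \<and> leaf_edge V ends (last es) \<and>
        (length es = 1 \<longrightarrow> leaf V ends (hd vs) \<and> leaf V ends (last vs)))"

text \<open>The edge set of a collection \<open>H\<close> is \<open>\<Union>H\<close>; \<open>\<Union>(ends ` p)\<close> is the node set of the path \<open>p\<close>.\<close>

definition disjoint_leaf_paths :: "'v set \<Rightarrow> ('e::finite \<Rightarrow> 'v set) \<Rightarrow> 'e set set \<Rightarrow> bool" where
  "disjoint_leaf_paths V ends H \<longleftrightarrow>
     (\<forall>p\<in>H. leaf_path V ends p) \<and>
     (\<forall>p\<in>H. \<forall>q\<in>H. p \<noteq> q \<longrightarrow> \<Union>(ends ` p) \<inter> \<Union>(ends ` q) = {})"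

definition char_vec :: "'e::finite set \<Rightarrow> real ^ 'e" where
  "char_vec S = (\<chi> e. indicator S e)"

definition tree_polytope :: "'v set \<Rightarrow> ('e::finite \<Rightarrow> 'v set) \<Rightarrow> (real ^ 'e) set" where
  "tree_polytope V ends =
     (if CARD('e) = 1 then {w. \<forall>e. 0 \<le> w $ e \<and> w $ e \<le> 1/2}
      else {w. \<forall>v a b c. internal_node V ends v \<and> incident ends v = {a, b, c} \<longrightarrow>
                 w $ a \<le> w $ b + w $ c \<and> w $ b \<le> w $ a + w $ c \<and> w $ c \<le> w $ a + w $ b \<and>
                 w $ a + w $ b + w $ c \<le> 1})"

definition skeleton_adjacent :: "'a::euclidean_space set \<Rightarrow> 'a \<Rightarrow> 'a \<Rightarrow> bool" where
  "skeleton_adjacent P w w' \<longleftrightarrow>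
     w extreme_point_of P \<and> w' extreme_point_of P \<and> w \<noteq> w' \<and> closed_segment w w' edge_of P"

end

theory Submission
  imports Defs
begin

text \<open>
  Call an edge set even if it meets the star of every internal node in an even number of edges;
  unions of disjoint leaf-paths are even. For even \<open>S\<close>, the affine involution replacing \<open>x\<^sub>e\<close> by
  \<open>1/2 - x\<^sub>e\<close> for \<open>e \<in> S\<close> preserves the polytope, since it permutes the vertices of the
  tetrahedron at each internal node. Hence one may assume \<open>w = 0\<close>, and then \<open>w'\<close> is half the
  characteristic vector of the symmetric difference \<open>D\<close>. A maximal path in the nonempty even
  set \<open>D\<close> is a leaf-path \<open>Q\<close>, and if \<open>Q \<noteq> D\<close> then \<open>D - Q\<close> is even too, so the midpoint of
  the segment from \<open>0\<close> to \<open>w'\<close> is also the midpoint of two points outside that segment.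
  Conversely, if \<open>D\<close> is a leaf-path, a point of the polytope vanishing outside \<open>D\<close> is constant
  on \<open>D\<close> by the triangle inequalities at the nodes of the path.
\<close>

section \<open>Even edge sets and their symmetric differences\<close>

definition even_edge_set :: "'v set \<Rightarrow> ('e::finite \<Rightarrow> 'v set) \<Rightarrow> 'e set \<Rightarrow> bool" where
  "even_edge_set V ends D \<longleftrightarrow> (\<forall>v. internal_node V ends v \<longrightarrow> even (card (D \<inter> incident ends v)))"

definition switch :: "'e::finite set \<Rightarrow> real ^ 'e \<Rightarrow> real ^ 'e" where
  "switch S x = (\<chi> e. if e \<in> S then 1/2 - x $ e else x $ e)"

lemma even_card_sym_diff:
  assumes "finite A" "finite B" "even (card A)" "even (card B)"
  shows "even (card (sym_diff A B))"
proof -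
  have "card (sym_diff A B) = card (A - B) + card (B - A)"
    using assms by (intro card_Un_disjoint) auto
  moreover have "card A = card (A - B) + card (A \<inter> B)"
    using assms by (metis add.commute card_Int_Diff)
  moreover have "card B = card (B - A) + card (A \<inter> B)"
    using assms by (metis Int_commute add.commute card_Int_Diff)
  ultimately show ?thesis using assms by presburger
qed

lemma even_edge_set_sym_diff:
  assumes "even_edge_set V ends A" "even_edge_set V ends B"
  shows "even_edge_set V ends (sym_diff A B)"
  unfolding even_edge_set_def
proof (intro allI impI)
  fix v assume "internal_node V ends v"
  moreover have "sym_diff A B \<inter> incident ends v
      = sym_diff (A \<inter> incident ends v) (B \<inter> incident ends v)" by auto
  ultimately show "even (card (sym_diff A B \<inter> incident ends v))"
    using assms even_card_sym_diff[of "A \<inter> incident ends v" "B \<inter> incident ends v"]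
    by (simp add: even_edge_set_def)
qed

subsection \<open>Paths\<close>

lemma graph_path_hd_last:
  assumes "graph_path V ends vs es"
  shows "hd vs = vs ! 0" "last vs = vs ! length es"
proof -
  have "length vs = Suc (length es)" "vs \<noteq> []" using assms by (auto simp: graph_path_def)
  then show "hd vs = vs ! 0" "last vs = vs ! length es" by (simp_all add: hd_conv_nth last_conv_nth)
qed

lemma graph_path_rev:
  assumes "graph_path V ends vs es"
  shows "graph_path V ends (rev vs) (rev es)"
  unfolding graph_path_def
proof (intro conjI allI impI)
  fix i assume i: "i < length (rev es)"
  have len: "length vs = Suc (length es)" using assms by (simp add: graph_path_def)
  have "ends (es ! (length es - Suc i)) = {vs ! (length es - Suc i), vs ! Suc (length es - Suc i)}"
    using assms i by (simp add: graph_path_def)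
  moreover have "Suc (length es - Suc i) = length es - i" using i by simp
  ultimately show "ends (rev es ! i) = {rev vs ! i, rev vs ! Suc i}"
    using i len by (auto simp: rev_nth)
qed (use assms in \<open>auto simp: graph_path_def\<close>)

lemma graph_path_drop:
  assumes "graph_path V ends vs es" "j \<le> length es"
  shows "graph_path V ends (drop j vs) (drop j es)"
  using assms by (auto simp: graph_path_def dest: in_set_dropD)

lemma graph_path_snoc:
  assumes "graph_path V ends vs es" "y \<in> V" "y \<notin> set vs" "ends f = {last vs, y}"
  shows "graph_path V ends (vs @ [y]) (es @ [f])"
  unfolding graph_path_def
proof (intro conjI allI impI)
  have len: "length vs = Suc (length es)" using assms by (simp add: graph_path_def)
  have last: "last vs = vs ! length es" by (rule graph_path_hd_last[OF assms(1)])
  fix i assume "i < length (es @ [f])"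
  then consider "i < length es" | "i = length es" by fastforce
  then show "ends ((es @ [f]) ! i) = {(vs @ [y]) ! i, (vs @ [y]) ! Suc i}"
    using assms len last by cases (auto simp: graph_path_def nth_append)
qed (use assms in \<open>auto simp: graph_path_def\<close>)

lemma graph_path_length_less_card:
  assumes "finite V" "graph_path V ends vs es"
  shows "length es < card V"
proof -
  have "card (set vs) = Suc (length es)"
    using assms distinct_card[of vs] by (simp add: graph_path_def)
  then show ?thesis using card_mono[of V "set vs"] assms by (simp add: graph_path_def)
qed

text \<open>Only the nodes of a path are distinct by definition. Equal edges at positions
  \<open>i\<close> and \<open>j\<close> have equal end pairs, and the crossed matching of these
  pairs would force both \<open>i = Suc j\<close> and \<open>Suc i = j\<close>.\<close>

lemma graph_path_distinct_edges:
  assumes "graph_path V ends vs es" "i < length es" "j < length es" "es ! i = es ! j"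
  shows "i = j"
proof -
  have d: "distinct vs" and len: "length vs = Suc (length es)"
    using assms by (auto simp: graph_path_def)
  have "{vs ! i, vs ! Suc i} = {vs ! j, vs ! Suc j}"
    using assms by (metis graph_path_def)
  then have "vs ! i = vs ! j \<or> vs ! i = vs ! Suc j \<and> vs ! Suc i = vs ! j"
    by (auto simp: doubleton_eq_iff)
  then show ?thesis
    using d len assms(2,3) by (auto simp: nth_eq_iff_index_eq)
qed

section \<open>Leaf-paths and their parity\<close>

lemma incident_leaf_unique:
  assumes "leaf V ends v" "v \<in> ends e" "v \<in> ends f"
  shows "e = f"
proof -
  obtain g where "incident ends v = {g}"
    using assms(1) by (auto simp: leaf_def degree_def card_1_singleton_iff)
  then have "e \<in> {g}" "f \<in> {g}" using assms(2,3) unfolding incident_def by blast+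
  then show ?thesis by simp
qed

text \<open>The leaf on an extreme edge must be the outer end of that edge: on a path with at least
  two edges, the inner end lies on two distinct edges and so is no leaf. This turns the condition on
  extreme edges into one on end nodes.\<close>

lemma leaf_path_obtain:
  assumes "leaf_path V ends p"
  obtains vs es where "graph_path V ends vs es" "es \<noteq> []" "set es = p"
    "leaf V ends (hd vs)" "leaf V ends (last vs)"
proof -
  obtain vs es where gp: "graph_path V ends vs es" and ne: "es \<noteq> []" and p: "set es = p"
    and lh: "leaf_edge V ends (hd es)" and ll: "leaf_edge V ends (last es)"
    and one: "length es = 1 \<longrightarrow> leaf V ends (hd vs) \<and> leaf V ends (last vs)"
    using assms by (auto simp: leaf_path_def)
  \<comment> \<open>Stated for an arbitrary path, so that applying it to the reversed path settles
    the last node.\<close>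
  have start_leaf: "leaf V ends (hd us)"
    if gp: "graph_path V ends us fs" and l: "leaf_edge V ends (hd fs)" and n: "2 \<le> length fs"
    for us fs
  proof -
    have ed: "ends (fs ! i) = {us ! i, us ! Suc i}" if "i < length fs" for i
      using gp that by (simp add: graph_path_def)
    have pos: "0 < length fs" "1 < length fs" using n by linarith+
    have e0: "ends (fs ! 0) = {us ! 0, us ! 1}" and e1: "ends (fs ! 1) = {us ! 1, us ! 2}"
      using ed[OF pos(1)] ed[OF pos(2)] by (simp_all add: numeral_2_eq_2)
    have "\<not> leaf V ends (us ! 1)"
    proof
      assume "leaf V ends (us ! 1)"
      then have "fs ! 0 = fs ! 1" using e0 e1 by (intro incident_leaf_unique) auto
      from graph_path_distinct_edges[OF gp pos this] show False by simp
    qed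
    moreover have "hd fs = fs ! 0" using n by (intro hd_conv_nth) auto
    moreover have "hd us = us ! 0" by (rule graph_path_hd_last[OF gp])
    ultimately show ?thesis using l e0 by (auto simp: leaf_edge_def)
  qed
  have "leaf V ends (hd vs) \<and> leaf V ends (last vs)"
  proof (cases "length es = 1")
    case False
    then have n: "2 \<le> length es" using ne by (cases es) (auto simp: Suc_le_eq)
    have "leaf V ends (hd (rev vs))"
      using start_leaf[OF graph_path_rev[OF gp]] ll ne n by (simp add: hd_rev)
    then show ?thesis using start_leaf[OF gp lh n] by (simp add: hd_rev)
  qed (use one in blast)
  with that gp ne p show ?thesis by blast
qed

lemma leaf_path_intro:
  assumes "graph_path V ends vs es" "es \<noteq> []" "leaf V ends (hd vs)" "leaf V ends (last vs)"
  shows "leaf_path V ends (set es)"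
proof -
  have "hd es = es ! 0" "last es = es ! (length es - 1)"
    using assms(2) by (simp_all add: hd_conv_nth last_conv_nth)
  then have "hd vs \<in> ends (hd es)" "last vs \<in> ends (last es)"
    using assms graph_path_hd_last[OF assms(1)] by (auto simp: graph_path_def)
  then show ?thesis unfolding leaf_path_def leaf_edge_def using assms by blast
qed

text \<open>An internal node on the path is not one of its ends, since these are leaves. Hence the
  path uses exactly two consecutive edges there, and none at a node off the path.\<close>

lemma leaf_path_even:
  assumes "leaf_path V ends p"
  shows "even_edge_set V ends p"
  unfolding even_edge_set_def
proof (intro allI impI)
  obtain vs es where gp: "graph_path V ends vs es" and ne: "es \<noteq> []" and p: "set es = p"
    and l: "leaf V ends (hd vs)" "leaf V ends (last vs)"
    using leaf_path_obtain[OF assms] by blast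
  have len: "length vs = Suc (length es)" and d: "distinct vs"
    and ed: "\<And>i. i < length es \<Longrightarrow> ends (es ! i) = {vs ! i, vs ! Suc i}"
    using gp by (auto simp: graph_path_def)
  fix v assume v: "internal_node V ends v"
  show "even (card (p \<inter> incident ends v))"
  proof (cases "v \<in> set vs")
    case False
    have "p \<inter> incident ends v = {}"
    proof (rule ccontr)
      assume "p \<inter> incident ends v \<noteq> {}"
      then obtain i where "i < length es" "v \<in> ends (es ! i)"
        by (auto simp: p[symmetric] incident_def in_set_conv_nth)
      then show False using ed[of i] False len by auto
    qed
    then show ?thesis by simp
  next
    case True
    then obtain i where i: "i \<le> length es" "v = vs ! i" using len by (auto simp: in_set_conv_nth less_Suc_eq_le)
    have "\<not> leaf V ends v" using v by (simp add: internal_node_def leaf_def)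
    then have "i \<noteq> 0" "i \<noteq> length es" using l i(2) graph_path_hd_last[OF gp] by metis+
    then obtain k where k: "i = Suc k" "Suc k < length es" using i(1) by (cases i) auto
    have "p \<inter> incident ends v = {es ! k, es ! Suc k}"
    proof
      show "{es ! k, es ! Suc k} \<subseteq> p \<inter> incident ends v"
        using k ed[of k] ed[of "Suc k"] i by (auto simp: incident_def p[symmetric])
      show "p \<inter> incident ends v \<subseteq> {es ! k, es ! Suc k}"
      proof
        fix e assume "e \<in> p \<inter> incident ends v"
        then obtain j where j: "j < length es" "e = es ! j" "v \<in> ends (es ! j)"
          by (auto simp: p[symmetric] incident_def in_set_conv_nth)
        then have "vs ! j = vs ! Suc k \<or> vs ! Suc j = vs ! Suc k" using ed[of j] i(2) k by auto
        then have "j = Suc k \<or> j = k" using d len k j(1) by (auto simp: nth_eq_iff_index_eq)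
        then show "e \<in> {es ! k, es ! Suc k}" using j by auto
      qed
    qed
    moreover have "es ! k \<noteq> es ! Suc k"
      using graph_path_distinct_edges[OF gp, of k "Suc k"] k by auto
    ultimately show ?thesis by simp
  qed
qed

text \<open>By vertex-disjointness at most one member of \<open>H\<close> passes through a given
  node, so parity there is that of a single leaf-path.\<close>

lemma disjoint_leaf_paths_even:
  assumes "disjoint_leaf_paths V ends H"
  shows "even_edge_set V ends (\<Union>H)"
  unfolding even_edge_set_def
proof (intro allI impI)
  fix v assume v: "internal_node V ends v"
  show "even (card (\<Union>H \<inter> incident ends v))"
  proof (cases "\<exists>p\<in>H. v \<in> \<Union>(ends ` p)")
    case True
    then obtain p where p: "p \<in> H" "v \<in> \<Union>(ends ` p)" by blast
    have "\<Union>H \<inter> incident ends v = p \<inter> incident ends v"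
    proof
      show "\<Union>H \<inter> incident ends v \<subseteq> p \<inter> incident ends v"
      proof
        fix e assume e: "e \<in> \<Union>H \<inter> incident ends v"
        then obtain q where q: "q \<in> H" "e \<in> q" "v \<in> \<Union>(ends ` q)" by (auto simp: incident_def)
        then have "q = p" using assms p unfolding disjoint_leaf_paths_def by blast
        then show "e \<in> p \<inter> incident ends v" using q e by blast
      qed
    qed (use p in blast)
    moreover have "leaf_path V ends p" using assms p by (simp add: disjoint_leaf_paths_def)
    ultimately show ?thesis using leaf_path_even[of V ends p] v by (simp add: even_edge_set_def)
  next
    case False
    then have "\<Union>H \<inter> incident ends v = {}" by (auto simp: incident_def)
    then show ?thesis by simp
  qed
qed

text \<open>A longest path inside \<open>D\<close> works. If its last node were internal, evenness
  would supply another edge of \<open>D\<close> there, which either prolongs the path or closes a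
  cycle.\<close>

lemma even_edge_set_contains_leaf_path:
  assumes tree: "one_three_tree V ends" and even: "even_edge_set V ends D" and "D \<noteq> {}"
  obtains Q where "leaf_path V ends Q" "Q \<subseteq> D"
proof -
  have fin: "finite V" and inj: "inj ends" and ends: "\<And>e. ends e \<subseteq> V" "\<And>e. card (ends e) = 2"
    and acyc: "acyclic_graph V ends"
    and deg: "\<And>v. v \<in> V \<Longrightarrow> degree ends v = 1 \<or> degree ends v = 3"
    using tree by (auto simp: one_three_tree_def simple_graph_def)
  define P where "P n \<longleftrightarrow> (\<exists>vs es. graph_path V ends vs es \<and> set es \<subseteq> D \<and> length es = n)" for n
  obtain e where e: "e \<in> D" using \<open>D \<noteq> {}\<close> by blast
  obtain a b where ab: "ends e = {a, b}" "a \<noteq> b" using ends(2)[of e] by (auto simp: card_2_iff)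
  have "graph_path V ends [a, b] [e]" using ab ends(1)[of e] by (simp add: graph_path_def)
  then have P1: "P 1" unfolding P_def using e by (intro exI[of _ "[a, b]"] exI[of _ "[e]"]) auto
  \<comment> \<open>Path lengths are bounded by the number of nodes, so the greatest length
    \<open>N\<close> exists.\<close>
  have bound: "n \<le> card V" if "P n" for n
    using that graph_path_length_less_card[OF fin] by (force simp: P_def)
  define N where "N = (GREATEST n. P n)"
  have PN: "P N" unfolding N_def by (rule GreatestI_nat[of P, OF P1 bound])
  have N_max: "n \<le> N" if "P n" for n
    unfolding N_def by (rule Greatest_le_nat[of P, OF that bound])
  have N1: "1 \<le> N" using N_max[OF P1] .
  have last_leaf: "leaf V ends (last vs)"
    if gp: "graph_path V ends vs es" and sub: "set es \<subseteq> D" and n: "length es = N" for vs es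
  proof (rule ccontr)
    assume nl: "\<not> leaf V ends (last vs)"
    have len: "length vs = Suc N" and d: "distinct vs" and vsV: "set vs \<subseteq> V"
      and ed: "\<And>i. i < N \<Longrightarrow> ends (es ! i) = {vs ! i, vs ! Suc i}"
      using gp n by (auto simp: graph_path_def)
    obtain k where k: "N = Suc k" using N1 by (cases N) auto
    have z: "last vs = vs ! N" using graph_path_hd_last[OF gp] n by simp
    then have zV: "last vs \<in> V" using len vsV by auto
    have "internal_node V ends (last vs)"
      using nl deg[OF zV] zV by (auto simp: leaf_def internal_node_def)
    then have ev: "even (card (D \<inter> incident ends (last vs)))"
      using even by (simp add: even_edge_set_def)
    have g: "es ! k \<in> D \<inter> incident ends (last vs)"
      using ed[of k] k n sub z by (auto simp: incident_def)
    \<comment> \<open>The last path edge alone would give the odd count 1.\<close>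
    have "D \<inter> incident ends (last vs) \<noteq> {es ! k}" using ev by auto
    then obtain f where f: "f \<in> D" "last vs \<in> ends f" "f \<noteq> es ! k"
      using g by (auto simp: incident_def)
    obtain y where y: "ends f = {last vs, y}" "y \<noteq> last vs"
      using ends(2)[of f] f(2) by (auto simp: card_2_iff insert_commute)
    have yV: "y \<in> V" using ends(1)[of f] y by auto
    show False
    proof (cases "y \<in> set vs")
      case False
      then have "graph_path V ends (vs @ [y]) (es @ [f])"
        using graph_path_snoc[OF gp yV _ y(1)] by simp
      then have "P (Suc N)" unfolding P_def using sub f n
        by (intro exI[of _ "vs @ [y]"] exI[of _ "es @ [f]"]) auto
      then show False using N_max by fastforce
    next
      case True
      then obtain j where j: "j < Suc N" "y = vs ! j" using len by (auto simp: in_set_conv_nth)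
      have "j \<noteq> N" using y j z by auto
      \<comment> \<open>Otherwise \<open>f\<close> would be parallel to the last edge of the path.
        With \<open>j < k\<close> the part of the path from \<open>y\<close> on has at least three
        nodes, as a cycle requires.\<close>
      moreover have "j \<noteq> k"
      proof
        assume "j = k"
        then have "ends f = ends (es ! k)" using y j z ed[of k] k by auto
        then show False using inj f(3) by (auto dest: injD)
      qed
      ultimately have jk: "j < k" using j k by simp
      have "graph_path V ends (drop j vs) (drop j es)"
        using graph_path_drop[OF gp, of j] j n by simp
      moreover have "3 \<le> length (drop j vs)" using jk k len by simp
      moreover have "ends f = {last (drop j vs), hd (drop j vs)}"
        using y j len by (simp add: hd_drop_conv_nth)
      ultimately show False using acyc unfolding acyclic_graph_def by blast
    qed
  qed
  obtain vs es where gp: "graph_path V ends vs es" and sub: "set es \<subseteq> D" and n: "length es = N"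
    using PN by (auto simp: P_def)
  \<comment> \<open>The reversed path is also longest, which settles the first node.\<close>
  have "leaf V ends (last (rev vs))"
    using last_leaf[OF graph_path_rev[OF gp]] sub n by simp
  then have "leaf V ends (hd vs)" by (simp add: last_rev)
  moreover have "es \<noteq> []" using n N1 by auto
  ultimately have "leaf_path V ends (set es)"
    using leaf_path_intro[OF gp] last_leaf[OF gp sub n] by blast
  then show ?thesis using that sub by blast
qed

subsection \<open>The polytope\<close>

text \<open>If both ends of \<open>e\<close> were leaves, no path could leave \<open>e\<close>, so
  connectedness would rule out a second edge.\<close>

lemma edge_incident_internal_node:
  fixes ends :: "'e::finite \<Rightarrow> 'v set"
  assumes tree: "one_three_tree V ends" and card: "CARD('e) \<noteq> 1"
  obtains v where "internal_node V ends v" "v \<in> ends e"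
proof (rule ccontr)
  have ends: "\<And>e. ends e \<subseteq> V" "\<And>e. card (ends e) = 2"
    and conn: "connected_graph V ends"
    and deg: "\<And>v. v \<in> V \<Longrightarrow> degree ends v = 1 \<or> degree ends v = 3"
    using tree by (auto simp: one_three_tree_def simple_graph_def)
  assume "\<not> thesis"
  then have leaves: "leaf V ends v" if "v \<in> ends e" for v
    using that \<open>\<And>v. internal_node V ends v \<Longrightarrow> v \<in> ends e \<Longrightarrow> thesis\<close> deg[of v] ends(1)[of e]
    by (auto simp: leaf_def internal_node_def)
  have "(UNIV :: 'e set) \<noteq> {e}" using card by (metis card_1_singleton_iff One_nat_def)
  then obtain f where f: "f \<noteq> e" by auto
  obtain a b where ab: "ends e = {a, b}" "a \<noteq> b" using ends(2)[of e] by (auto simp: card_2_iff)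
  obtain c where c: "c \<in> ends f" using ends(2)[of f] by fastforce
  have "c \<notin> ends e" using incident_leaf_unique leaves c f by metis
  then have cab: "c \<noteq> a" "c \<noteq> b" using ab by auto
  have "a \<in> V" "c \<in> V" using ends(1)[of e] ends(1)[of f] ab c by auto
  then obtain vs es where gp: "graph_path V ends vs es" and hd: "hd vs = a" and la: "last vs = c"
    using conn unfolding connected_graph_def by blast
  have ed: "\<And>i. i < length es \<Longrightarrow> ends (es ! i) = {vs ! i, vs ! Suc i}"
    using gp by (auto simp: graph_path_def)
  have v0: "vs ! 0 = a" and vl: "vs ! length es = c"
    using hd la graph_path_hd_last[OF gp] by auto
  \<comment> \<open>While the path is at \<open>a\<close> or \<open>b\<close>, both assumed to be
    leaves, its next edge can only be \<open>e\<close>.\<close>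
  have "vs ! i \<in> {a, b}" if "i \<le> length es" for i
    using that
  proof (induction i)
    case (Suc i)
    then have "vs ! i \<in> ends e" "vs ! i \<in> ends (es ! i)" using ed[of i] ab by auto
    then have "es ! i = e" using incident_leaf_unique leaves by metis
    then show ?case using ed[of i] ab Suc.prems by auto
  qed (use v0 in simp)
  then show False using vl cab by auto
qed

lemma internal_node_incident:
  assumes "internal_node V ends v" "e \<in> incident ends v"
  obtains b c where "incident ends v = {e, b, c}"
proof -
  have "card (incident ends v) = 3" using assms by (simp add: internal_node_def degree_def)
  then obtain x y z where "incident ends v = {x, y, z}"
    by (auto simp: card_3_iff)
  with assms(2) show ?thesis
    using that[of y z] that[of x z] that[of x y] by (auto simp: insert_commute)
qed

lemma incident_distinct:
  assumes "internal_node V ends v" "incident ends v = {a, b, c}"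
  shows "a \<noteq> b" "a \<noteq> c" "b \<noteq> c"
  using assms by (auto simp: internal_node_def degree_def card_insert_if split: if_splits)

text \<open>This removes the case distinction on the number of edges. With several edges, each edge
  \<open>e\<close> meets an internal node: adding the two triangle inequalities with
  \<open>x $ e\<close> on the right gives the lower bound, and adding the remaining one to the sum
  bound gives the upper bound. A single edge leaves no internal node.\<close>

lemma mem_tree_polytope_iff:
  fixes ends :: "'e::finite \<Rightarrow> 'v set"
  assumes tree: "one_three_tree V ends"
  shows "x \<in> tree_polytope V ends \<longleftrightarrow>
    (\<forall>e. 0 \<le> x $ e \<and> x $ e \<le> 1/2) \<and>
    (\<forall>v a b c. internal_node V ends v \<and> incident ends v = {a, b, c} \<longrightarrow>
       x $ a \<le> x $ b + x $ c \<and> x $ b \<le> x $ a + x $ c \<and> x $ c \<le> x $ a + x $ b \<and>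
       x $ a + x $ b + x $ c \<le> 1)"
proof (cases "CARD('e) = 1")
  case True
  have "\<not> internal_node V ends v" for v
  proof
    assume "internal_node V ends v"
    then have "card (incident ends v) = 3" by (simp add: internal_node_def degree_def)
    moreover have "card (incident ends v) \<le> CARD('e)" by (intro card_mono) auto
    ultimately show False using True by simp
  qed
  with True show ?thesis by (simp add: tree_polytope_def)
next
  case False
  have "0 \<le> x $ e \<and> x $ e \<le> 1/2" if x: "x \<in> tree_polytope V ends" for e
  proof -
    obtain v where v: "internal_node V ends v" "e \<in> incident ends v"
      using edge_incident_internal_node[OF tree False, of e] by (auto simp: incident_def)
    then obtain b c where "incident ends v = {e, b, c}"
      using internal_node_incident by metis
    then have "x $ e \<le> x $ b + x $ c \<and> x $ b \<le> x $ e + x $ c \<and> x $ c \<le> x $ e + x $ b \<and>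
       x $ e + x $ b + x $ c \<le> 1"
      using x v(1) False unfolding tree_polytope_def by auto
    then show ?thesis by linarith
  qed
  then show ?thesis using False unfolding tree_polytope_def by auto
qed

section \<open>Even subsets of a star and the switching symmetry\<close>

lemma even_edge_set_incident_cases:
  assumes "even_edge_set V ends S" "internal_node V ends v" "incident ends v = {a, b, c}"
  shows "a \<notin> S \<and> b \<notin> S \<and> c \<notin> S \<or> a \<in> S \<and> b \<in> S \<and> c \<notin> S \<or>
    a \<in> S \<and> b \<notin> S \<and> c \<in> S \<or> a \<notin> S \<and> b \<in> S \<and> c \<in> S"
proof -
  have "even (card (S \<inter> {a, b, c}))" using assms by (auto simp: even_edge_set_def)
  then show ?thesis using incident_distinct[OF assms(2,3)]
    by (cases "a \<in> S"; cases "b \<in> S"; cases "c \<in> S") auto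
qed

text \<open>At each internal node \<open>S\<close> contains no edge or exactly two. In the latter
  case the substitution permutes the four inequalities of that node; the interval from 0 to 1/2 is
  mapped to itself.\<close>

lemma switch_in_tree_polytope:
  assumes tree: "one_three_tree V ends" and S: "even_edge_set V ends S"
    and x: "x \<in> tree_polytope V ends"
  shows "switch S x \<in> tree_polytope V ends"
proof -
  note x' = x[unfolded mem_tree_polytope_iff[OF tree]]
  show ?thesis
    unfolding mem_tree_polytope_iff[OF tree]
  proof (rule conjI; intro allI impI; (elim conjE)?)
    fix e show "0 \<le> switch S x $ e \<and> switch S x $ e \<le> 1/2"
      using x' by (auto simp: switch_def)
  next
    fix v a b c assume v: "internal_node V ends v" "incident ends v = {a, b, c}"
    have "x $ a \<le> x $ b + x $ c \<and> x $ b \<le> x $ a + x $ c \<and> x $ c \<le> x $ a + x $ b \<and>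
       x $ a + x $ b + x $ c \<le> 1" using x' v by blast
    then show "switch S x $ a \<le> switch S x $ b + switch S x $ c \<and>
       switch S x $ b \<le> switch S x $ a + switch S x $ c \<and>
       switch S x $ c \<le> switch S x $ a + switch S x $ b \<and>
       switch S x $ a + switch S x $ b + switch S x $ c \<le> 1"
      using even_edge_set_incident_cases[OF S v] by (auto simp: switch_def)
  qed
qed

lemma switch_switch [simp]: "switch S (switch S x) = x"
  by (simp add: switch_def vec_eq_iff)

lemma switch_tree_polytope:
  assumes "one_three_tree V ends" "even_edge_set V ends S"
  shows "switch S ` tree_polytope V ends = tree_polytope V ends"
proof
  show "tree_polytope V ends \<subseteq> switch S ` tree_polytope V ends"
    using switch_in_tree_polytope[OF assms] switch_switch by (metis image_eqI subsetI)
qed (use switch_in_tree_polytope[OF assms] in blast)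

section \<open>Half characteristic vectors and the segments joining them\<close>

lemma switch_half_char_vec:
  "switch S ((1/2) *\<^sub>R char_vec T) = (1/2) *\<^sub>R char_vec (sym_diff S T)"
  unfolding vec_eq_iff by (auto simp: switch_def char_vec_def indicator_def)

lemma half_char_vec_empty [simp]: "(1/2) *\<^sub>R char_vec {} = 0"
  unfolding vec_eq_iff by (simp add: char_vec_def)

text \<open>At an internal node the coordinates are all zero, or two equal \<open>t/2\<close> and
  the third is zero. The factor \<open>t\<close> covers the whole segment from the origin.\<close>

lemma scaled_half_char_vec_in_tree_polytope:
  assumes tree: "one_three_tree V ends" and S: "even_edge_set V ends S" and t: "0 \<le> t" "t \<le> 1"
  shows "t *\<^sub>R ((1/2) *\<^sub>R char_vec S) \<in> tree_polytope V ends"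
  unfolding mem_tree_polytope_iff[OF tree]
proof (rule conjI; intro allI impI; (elim conjE)?)
  fix v a b c assume v: "internal_node V ends v" "incident ends v = {a, b, c}"
  let ?x = "t *\<^sub>R ((1/2) *\<^sub>R char_vec S)"
  show "?x $ a \<le> ?x $ b + ?x $ c \<and> ?x $ b \<le> ?x $ a + ?x $ c \<and> ?x $ c \<le> ?x $ a + ?x $ b \<and>
      ?x $ a + ?x $ b + ?x $ c \<le> 1"
    using even_edge_set_incident_cases[OF S v] t by (auto simp: char_vec_def)
qed (use t in \<open>auto simp: char_vec_def indicator_def\<close>)

lemma half_char_vec_in_tree_polytope:
  assumes "one_three_tree V ends" "even_edge_set V ends S"
  shows "(1/2) *\<^sub>R char_vec S \<in> tree_polytope V ends"
  using scaled_half_char_vec_in_tree_polytope[OF assms, of 1] by simp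

lemma switch_segment_face_of:
  "closed_segment (switch S x) (switch S y) face_of switch S ` P \<longleftrightarrow> closed_segment x y face_of P"
proof -
  \<comment> \<open>\<open>L\<close> is the linear part of \<open>switch S\<close>, a change of
    signs on \<open>S\<close>. Faces are carried along by this injective linear map and then by a
    translation.\<close>
  define L where "L = (\<lambda>x :: real ^ 'a. \<chi> e. if e \<in> S then - x $ e else x $ e)"
  have lin: "linear L" by (rule linearI) (auto simp: L_def vec_eq_iff)
  have inj: "inj L"
  proof (rule injI)
    fix x y assume "L x = L y"
    then have "L x $ e = L y $ e" for e by simp
    then show "x = y" unfolding L_def vec_eq_iff by (simp split: if_splits) (metis neg_equal_iff_equal)
  qed
  have sw: "switch S = (\<lambda>x. (1/2) *\<^sub>R char_vec S + L x)"
    by (rule ext) (auto simp: switch_def L_def vec_eq_iff char_vec_def)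
  have im: "switch S ` P = (+) ((1/2) *\<^sub>R char_vec S) ` L ` P" by (simp add: sw image_image)
  have seg: "closed_segment (switch S x) (switch S y)
      = (+) ((1/2) *\<^sub>R char_vec S) ` L ` closed_segment x y"
    by (simp add: sw closed_segment_translation closed_segment_linear_image[OF lin])
  show ?thesis unfolding im seg
    by (simp only: face_of_translation_eq face_of_linear_image[OF lin inj])
qed

text \<open>At an inner node of the path the third edge lies outside \<open>D\<close> and has
  coordinate zero, so two triangle inequalities force equal values on the consecutive path
  edges.\<close>

lemma leaf_path_constant:
  assumes tree: "one_three_tree V ends" and x: "x \<in> tree_polytope V ends"
    and D: "leaf_path V ends D" and zero: "\<And>e. e \<notin> D \<Longrightarrow> x $ e = 0"
  obtains t where "0 \<le> t" "t \<le> 1" "x = t *\<^sub>R ((1/2) *\<^sub>R char_vec D)"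
proof -
  note x' = x[unfolded mem_tree_polytope_iff[OF tree]]
  obtain vs es where gp: "graph_path V ends vs es" and ne: "es \<noteq> []" and p: "set es = D"
    using leaf_path_obtain[OF D] by blast
  have len: "length vs = Suc (length es)" and vsV: "set vs \<subseteq> V"
    and ed: "\<And>i. i < length es \<Longrightarrow> ends (es ! i) = {vs ! i, vs ! Suc i}"
    using gp by (auto simp: graph_path_def)
  have const: "x $ (es ! i) = x $ (es ! 0)" if "i < length es" for i
    using that
  proof (induction i)
    case (Suc i)
    let ?v = "vs ! Suc i"
    have v: "?v \<in> ends (es ! i)" "?v \<in> ends (es ! Suc i)" using ed Suc.prems by auto
    have neq: "es ! i \<noteq> es ! Suc i"
      using graph_path_distinct_edges[OF gp, of i "Suc i"] Suc.prems by auto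
    have "?v \<in> V" using vsV len Suc.prems by auto
    moreover have "\<not> leaf V ends ?v" using incident_leaf_unique v neq by metis
    ultimately have int: "internal_node V ends ?v"
      using tree by (auto simp: one_three_tree_def leaf_def internal_node_def)
    obtain b c where bc: "incident ends ?v = {es ! i, b, c}"
      using internal_node_incident[OF int, of "es ! i"] v(1) unfolding incident_def by blast
    have "es ! Suc i \<in> incident ends ?v" using v(2) by (simp add: incident_def)
    then have "es ! Suc i \<in> {b, c}" using bc neq by simp
    then obtain c where c: "incident ends ?v = {es ! i, es ! Suc i, c}"
      using bc by (auto simp: insert_commute)
    have "c \<notin> D"
      using even_edge_set_incident_cases[OF leaf_path_even[OF D] int c] Suc.prems p by auto
    then have "x $ c = 0" by (rule zero)
    moreover have "x $ (es ! i) \<le> x $ (es ! Suc i) + x $ c" "x $ (es ! Suc i) \<le> x $ (es ! i) + x $ c"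
      using x' int c by blast+
    ultimately show ?case using Suc by simp
  qed simp
  have "x $ e = x $ (es ! 0)" if "e \<in> D" for e
    using that const by (auto simp: p[symmetric] in_set_conv_nth)
  \<comment> \<open>The factor 2 cancels the 1/2 in the vector, and the coordinate bound 1/2 becomes
    the bound 1 on \<open>t\<close>.\<close>
  then have "x = (2 * x $ (es ! 0)) *\<^sub>R ((1/2) *\<^sub>R char_vec D)"
    using zero unfolding vec_eq_iff by (auto simp: char_vec_def indicator_def)
  moreover have "0 \<le> 2 * x $ (es ! 0)" "2 * x $ (es ! 0) \<le> 1"
    using x'[THEN conjunct1, rule_format, of "es ! 0"] by simp_all
  ultimately show ?thesis using that by blast
qed

text \<open>The adjacency criterion with one vertex moved to the origin, the case to which switching
  reduces the theorem.\<close>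

lemma face_of_zero_half_char_vec_iff:
  assumes tree: "one_three_tree V ends" and even: "even_edge_set V ends D" and ne: "D \<noteq> {}"
  shows "closed_segment 0 ((1/2) *\<^sub>R char_vec D) face_of tree_polytope V ends \<longleftrightarrow> leaf_path V ends D"
proof
  let ?P = "tree_polytope V ends" and ?d = "(1/2) *\<^sub>R char_vec D"
  assume face: "closed_segment 0 ?d face_of ?P"
  obtain Q where Q: "leaf_path V ends Q" "Q \<subseteq> D"
    using even_edge_set_contains_leaf_path[OF tree even ne] by blast
  have "Q \<noteq> {}" using Q(1) by (auto simp: leaf_path_def)
  then obtain e where e: "e \<in> Q" by blast
  have evQ: "even_edge_set V ends Q" by (rule leaf_path_even[OF Q(1)])
  moreover have "sym_diff D Q = D - Q" using Q(2) by auto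
  ultimately have evDQ: "even_edge_set V ends (D - Q)" using even_edge_set_sym_diff[OF even] by metis
  let ?q = "(1/2) *\<^sub>R char_vec Q" and ?r = "(1/2) *\<^sub>R char_vec (D - Q)"
  have "?q $ e \<noteq> ?r $ e" using e by (simp add: char_vec_def)
  then have "?q \<noteq> ?r" by metis
  then have "midpoint ?q ?r \<in> open_segment ?q ?r" by simp
  \<comment> \<open>\<open>Q\<close> and \<open>D - Q\<close> partition \<open>D\<close>, so
    \<open>?q\<close> and \<open>?r\<close> add up to \<open>?d\<close>. The face property then
    forces \<open>?q\<close> onto the segment.\<close>
  moreover have "midpoint ?q ?r = midpoint 0 ?d"
    using Q(2) unfolding vec_eq_iff by (auto simp: midpoint_def char_vec_def indicator_def)
  then have "midpoint ?q ?r \<in> closed_segment 0 ?d" by (metis midpoint_in_closed_segment)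
  ultimately have "?q \<in> closed_segment 0 ?d"
    using face half_char_vec_in_tree_polytope[OF tree evQ] half_char_vec_in_tree_polytope[OF tree evDQ]
    unfolding face_of_def by blast
  then obtain u where u: "?q = u *\<^sub>R ?d" by (auto simp: in_segment)
  have "D \<subseteq> Q"
  proof
    fix f assume f: "f \<in> D"
    have "?q $ h = u * ?d $ h" for h unfolding u by simp
    \<comment> \<open>The coordinate at \<open>e\<close> gives \<open>u = 1\<close>, so the
      coordinate of \<open>?q\<close> at \<open>f\<close> is nonzero.\<close>
    from this[of e] this[of f] show "f \<in> Q"
      using e f Q(2) by (auto simp: char_vec_def indicator_def split: if_splits)
  qed
  then show "leaf_path V ends D" using Q by auto
next
  let ?P = "tree_polytope V ends" and ?d = "(1/2) *\<^sub>R char_vec D"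
  assume D: "leaf_path V ends D"
  \<comment> \<open>Proved for one end only; exchanging \<open>a\<close> and \<open>b\<close> yields
    the other.\<close>
  have mem: "a \<in> closed_segment 0 ?d"
    if a: "a \<in> ?P" and b: "b \<in> ?P" and z: "z \<in> closed_segment 0 ?d" and zo: "z \<in> open_segment a b"
    for a b z
  proof -
    obtain u where u: "0 < u" "u < 1" "z = (1 - u) *\<^sub>R a + u *\<^sub>R b" using zo by (auto simp: in_segment)
    \<comment> \<open>Outside \<open>D\<close> the point \<open>z\<close> vanishes, and it is a
      convex combination, with positive weights, of nonnegative coordinates.\<close>
    have "a $ e = 0" if e: "e \<notin> D" for e
    proof -
      obtain s where "z = s *\<^sub>R ?d" using z by (auto simp: in_segment)
      then have "z $ e = 0" using e by (simp add: char_vec_def)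
      then have "(1 - u) * a $ e + u * b $ e = 0" using u by simp
      moreover have ab: "0 \<le> a $ e" "0 \<le> b $ e"
        using a b unfolding mem_tree_polytope_iff[OF tree] by auto
      moreover have "0 \<le> u * b $ e" "0 \<le> (1 - u) * a $ e" using u ab by simp_all
      ultimately have "(1 - u) * a $ e = 0" by linarith
      then show ?thesis using u by simp
    qed
    then obtain t where "0 \<le> t" "t \<le> 1" "a = t *\<^sub>R ?d"
      using leaf_path_constant[OF tree a D] by blast
    then show ?thesis by (auto simp: in_segment)
  qed
  show "closed_segment 0 ?d face_of ?P"
    unfolding face_of_def
  proof (intro conjI ballI impI; (elim conjE)?)
    show "closed_segment 0 ?d \<subseteq> ?P"
      using scaled_half_char_vec_in_tree_polytope[OF tree even] by (auto simp: in_segment)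
    fix a b z
    assume a: "a \<in> ?P" and b: "b \<in> ?P" and z: "z \<in> closed_segment 0 ?d"
      and zo: "z \<in> open_segment a b"
    show "a \<in> closed_segment 0 ?d" by (rule mem[OF a b z zo])
    show "b \<in> closed_segment 0 ?d" using mem[OF b a z] zo by (simp add: open_segment_commute)
  qed simp
qed

theorem theorem5:
  fixes V :: "'v set" and ends :: "'e::finite \<Rightarrow> 'v set"
    and w w' :: "real ^ 'e" and H H' :: "'e set set"
  assumes "one_three_tree V ends"
    and "w extreme_point_of tree_polytope V ends"
    and "w' extreme_point_of tree_polytope V ends"
    and "w \<noteq> w'"
    and "disjoint_leaf_paths V ends H" and "w = (1/2) *\<^sub>R char_vec (\<Union>H)"
    and "disjoint_leaf_paths V ends H'" and "w' = (1/2) *\<^sub>R char_vec (\<Union>H')"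
  shows "skeleton_adjacent (tree_polytope V ends) w w' \<longleftrightarrow>
         leaf_path V ends (sym_diff (\<Union>H) (\<Union>H'))"
proof -
  let ?S = "\<Union>H" and ?S' = "\<Union>H'" and ?P = "tree_polytope V ends"
  have ev: "even_edge_set V ends ?S" "even_edge_set V ends ?S'"
    using assms disjoint_leaf_paths_even by blast+
  have ne: "sym_diff ?S ?S' \<noteq> {}" using assms(4,6,8) by auto
  \<comment> \<open>A polytope edge is a face of dimension 1, so for distinct vertices only the face
    condition remains.\<close>
  have "aff_dim (closed_segment w w') = 1"
    using assms(4) by (simp add: segment_convex_hull aff_dim_convex_hull)
  then have "skeleton_adjacent ?P w w' \<longleftrightarrow> closed_segment w w' face_of ?P"
    using assms(2-4) by (simp add: skeleton_adjacent_def edge_of_def)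
  also have "\<dots> \<longleftrightarrow> closed_segment (switch ?S w) (switch ?S w') face_of ?P"
    using switch_segment_face_of[of ?S w w' ?P] switch_tree_polytope[OF assms(1) ev(1)] by simp
  \<comment> \<open>Switching by \<open>?S\<close> acts on the underlying edge sets as symmetric
    difference with \<open>?S\<close>, which sends \<open>w\<close> to the origin.\<close>
  also have "\<dots> \<longleftrightarrow> closed_segment 0 ((1/2) *\<^sub>R char_vec (sym_diff ?S ?S')) face_of ?P"
    unfolding assms(6,8) switch_half_char_vec by simp
  also have "\<dots> \<longleftrightarrow> leaf_path V ends (sym_diff ?S ?S')"
    by (rule face_of_zero_half_char_vec_iff[OF assms(1) even_edge_set_sym_diff[OF ev] ne])
  finally show ?thesis .
qed

end
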